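(* Let $E_2$ be the set of $2\times 2$ fractal tiling configurations with exactly one zero element, taken without redundancy (i.e. configurations generating the same matrices $M_k$ for all $k\ge 0$ are identified, so that each class of identical configurations is counted as one element). Then the number of different configurations for the group action of $G$ on $E_2$, i.e. the number $|E_2/G|$ of $G$-orbits in $E_2$, is $232$.
   Context: The group $G$. $G$ is the planar symmetry group of order 8 acting on square matrices (of any size) viewed as plane patterns. Its elements are: $R_0=\mathrm{Id},R_1,R_2,R_3$, the counterclockwise rotations by $0^\circ,90^\circ,180^\circ,270^\circ$; and $K_i=M\circ R_i$ ($i=0,1,2,3$), where $M$ is the horizontal mirror transformation (reflection across the horizontal axis, reversing the order of the rows). Thus $K_1$ is the ordinary transpose (reflection in the principal diagonal, from upper left to lower right) and $K_3$ is the reflection in the second diagonal. Configurations and generated matrices. An $n\times n$ configuration $c$ assigns to each position $(i,j)$, $1\le i,j\le n$, either the symbol $0$ or a transformation $c_{ij}\in G$. Its initial tile is the binary matrix $M_0$ with $M_0(i,j)=0$ if $c_{ij}=0$ and $M_0(i,j)=1$ otherwise. For $k\ge 0$, the matrix $M_{k+1}$, of size $n^{k+2}\times n^{k+2}$, is the $n\times n$ block matrix whose $(i,j)$ block is the zero matrix of the size of $M_k$ if $c_{ij}=0$, and is $c_{ij}(M_k)$ if $c_{ij}\in G$. Two configurations are identical if they generate the same matrix $M_k$ for every $k\ge 0$. The set $E_2$. Here $n=2$ and one considers the $4\cdot 8^3=2048$ configurations with exactly one position equal to $0$, the other three being elements of $G$. $E_2$ is the set of classes of these configurations modulo being identical (equivalently,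 one representative is kept from each class). The action of $G$. For $T\in G$ let $\pi_T$ be the permutation of positions induced by $T$ (the entry of a matrix $A$ at position $p$ appears in $T(A)$ at position $\pi_T(p)$). $T$ sends a configuration $c$ to the configuration $T\cdot c$ with $(T\cdot c)_{\pi_T(p)}=T c_p T^{-1}$ if $c_p\in G$ and $(T\cdot c)_{\pi_T(p)}=0$ if $c_p=0$. Equivalently, if $c$ generates $(M_k)_{k\ge0}$, then $T\cdot c$ generates $(T(M_k))_{k\ge 0}$. This induces an action of $G$ on $E_2$: two configurations are in the same orbit when the pattern of one is obtained from that of the other by a rotation and/or mirror reflection. *)

theory Defs
  imports "Jordan_Normal_Form.Matrix" "HOL-Algebra.Group_Action"
begin

section \<open>The planar symmetry group of order 8\<close>

text \<open>\<open>R i\<close> is the counterclockwise rotation by \<open>90 * i\<close> degrees and \<open>K i\<close> is \<open>M \<circ> R i\<close>, where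
  \<open>M\<close> reverses the order of the rows; only the indices \<open>i < 4\<close> occur in the group.\<close>

datatype planar_sym = R nat | K nat

definition rot_ccw :: "'a mat \<Rightarrow> 'a mat" where
  "rot_ccw A = mat (dim_col A) (dim_row A) (\<lambda>(i, j). A $$ (j, dim_col A - 1 - i))"

definition mirror :: "'a mat \<Rightarrow> 'a mat" where
  "mirror A = mat (dim_row A) (dim_col A) (\<lambda>(i, j). A $$ (dim_row A - 1 - i, j))"

fun transform :: "planar_sym \<Rightarrow> 'a mat \<Rightarrow> 'a mat" where
  "transform (R i) A = (rot_ccw ^^ i) A"
| "transform (K i) A = mirror ((rot_ccw ^^ i) A)"

text \<open>Composition, from \<open>R i \<circ> M = M \<circ> R (- i)\<close>; modulo 4, \<open>3 * i\<close> is \<open>- i\<close>. The lemma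
  \<open>transform_comp\<close> below confirms that this is the composition of the transformations.\<close>

fun sym_comp :: "planar_sym \<Rightarrow> planar_sym \<Rightarrow> planar_sym" where
  "sym_comp (R i) (R j) = R ((i + j) mod 4)"
| "sym_comp (R i) (K j) = K ((3 * i + j) mod 4)"
| "sym_comp (K i) (R j) = K ((i + j) mod 4)"
| "sym_comp (K i) (K j) = R ((3 * i + j) mod 4)"

definition planar_group :: "planar_sym monoid" where
  "planar_group = \<lparr>carrier = R ` {..<4} \<union> K ` {..<4}, mult = sym_comp, one = R 0\<rparr>"

section \<open>Configurations and generated matrices\<close>

text \<open>A configuration is a matrix with entries \<open>None\<close> (the symbol 0) or \<open>Some T\<close> with \<open>T\<close> in
  the group. Matrix indices start at 0.\<close>

definition configurations :: "nat \<Rightarrow> planar_sym option mat set" where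
  "configurations n = {c \<in> carrier_mat n n.
     \<forall>i<n. \<forall>j<n. c $$ (i, j) = None \<or> (\<exists>T \<in> carrier planar_group. c $$ (i, j) = Some T)}"

text \<open>\<open>generated c k\<close> is \<open>M\<^sub>k\<close>, of size \<open>n ^ (k + 1)\<close>.\<close>

fun generated :: "planar_sym option mat \<Rightarrow> nat \<Rightarrow> nat mat" where
  "generated c 0 = map_mat (\<lambda>e. if e = None then 0 else 1) c"
| "generated c (Suc k) =
     (let s = dim_row c ^ (k + 1) in
      mat (dim_row c * s) (dim_row c * s)
        (\<lambda>(i, j). case c $$ (i div s, j div s) of
            None \<Rightarrow> 0
          | Some T \<Rightarrow> transform T (generated c k) $$ (i mod s, j mod s)))"

definition one_zero_configs :: "planar_sym option mat set" where
  "one_zero_configs = {c \<in> configurations 2.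
     card {(i, j). i < 2 \<and> j < 2 \<and> c $$ (i, j) = None} = 1}"

definition identical :: "(planar_sym option mat \<times> planar_sym option mat) set" where
  "identical = {(c, d). c \<in> one_zero_configs \<and> d \<in> one_zero_configs \<and>
     (\<forall>k. generated c k = generated d k)}"

definition E2 :: "planar_sym option mat set set" where
  "E2 = one_zero_configs // identical"

section \<open>The action of the group\<close>

text \<open>Conjugate every nonzero entry by \<open>T\<close>, then let \<open>T\<close> move the positions.\<close>

definition config_act :: "planar_sym \<Rightarrow> planar_sym option mat \<Rightarrow> planar_sym option mat" where
  "config_act T c = transform T
     (map_mat (map_option (\<lambda>g. T \<otimes>\<^bsub>planar_group\<^esub> g \<otimes>\<^bsub>planar_group\<^esub> inv\<^bsub>planar_group\<^esub> T)) c)"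

definition class_act :: "planar_sym \<Rightarrow> planar_sym option mat set \<Rightarrow> planar_sym option mat set" where
  "class_act T = (\<lambda>X \<in> E2. config_act T ` X)"

section \<open>Consistency of the definitions\<close>

lemma rot_dim [simp]: "dim_row (rot_ccw A) = dim_col A" "dim_col (rot_ccw A) = dim_row A"
  by (simp_all add: rot_ccw_def)

lemma mirror_dim [simp]: "dim_row (mirror A) = dim_row A" "dim_col (mirror A) = dim_col A"
  by (simp_all add: mirror_def)

lemma rot_ccw_4: "rot_ccw (rot_ccw (rot_ccw (rot_ccw A))) = A"
  by (rule eq_matI) (auto simp: rot_ccw_def)

lemma mirror_mirror: "mirror (mirror A) = A"
  by (rule eq_matI) (auto simp: mirror_def)

lemma rot_mirror: "rot_ccw (mirror A) = mirror (rot_ccw (rot_ccw (rot_ccw A)))"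
  by (rule eq_matI) (auto simp: mirror_def rot_ccw_def)

lemma transform_K1: "transform (K 1) A = transpose_mat A"
  by (rule eq_matI) (auto simp: mirror_def rot_ccw_def)

lemma rot_ccw_mod: "(rot_ccw ^^ (n mod 4)) A = (rot_ccw ^^ n) A"
proof -
  have "(rot_ccw ^^ (4 * q)) B = B" for q and B :: "'a mat"
    by (induction q) (simp_all add: funpow_add rot_ccw_4 numeral_eq_Suc)
  moreover have "(rot_ccw ^^ n) A = (rot_ccw ^^ (4 * (n div 4))) ((rot_ccw ^^ (n mod 4)) A)"
    by (metis comp_apply funpow_add mult_div_mod_eq)
  ultimately show ?thesis by simp
qed

lemma rot_pow_mirror: "(rot_ccw ^^ i) (mirror A) = mirror ((rot_ccw ^^ (3 * i)) A)"
  by (induction i) (simp_all add: rot_mirror numeral_eq_Suc)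

lemma transform_comp: "transform (sym_comp S T) A = transform S (transform T A)"
  by (cases S; cases T)
    (simp_all add: rot_ccw_mod rot_pow_mirror funpow_add mirror_mirror)

lemma planar_carrier: "carrier planar_group = {R 0, R 1, R 2, R 3, K 0, K 1, K 2, K 3}"
proof -
  have "{..<4::nat} = {0, 1, 2, 3}" by auto
  then show ?thesis by (auto simp: planar_group_def)
qed

lemma planar_group_simps [simp]:
  "mult planar_group = sym_comp" "one planar_group = R 0"
  by (simp_all add: planar_group_def)

lemma planar_order: "order planar_group = 8"
  by (simp add: order_def planar_carrier)

lemma planar_carrier_iff [simp]:
  "R i \<in> carrier planar_group \<longleftrightarrow> i < 4" "K i \<in> carrier planar_group \<longleftrightarrow> i < 4"
  by (auto simp: planar_group_def)

lemma sym_comp_assoc: "sym_comp (sym_comp S T) U = sym_comp S (sym_comp T U)"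
proof -
  have 1: "(a mod 4 + b) mod 4 = (a + b) mod 4" "(b + a mod 4) mod 4 = (b + a) mod 4"
    "(3 * (a mod 4) + b) mod 4 = (3 * a + b) mod 4" for a b :: nat
    by (rule mod_add_left_eq, rule mod_add_right_eq) (metis mod_add_left_eq mod_mult_right_eq)
  have 2: "(b + (c + a * 9)) mod 4 = (a + (b + c)) mod 4" for a b c :: nat
    using mod_mult_self1[of "a + (b + c)" "2 * a" 4] by (simp add: algebra_simps)
  show ?thesis
    by (cases S; cases T; cases U) (simp_all only: sym_comp.simps 1, simp_all add: algebra_simps 2)
qed

lemma group_planar: "group planar_group"
proof (rule groupI)
  show "x \<otimes>\<^bsub>planar_group\<^esub> y \<in> carrier planar_group" for x y
    by (cases x; cases y) simp_all
  show "\<one>\<^bsub>planar_group\<^esub> \<otimes>\<^bsub>planar_group\<^esub> x = x" if "x \<in> carrier planar_group" for x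
    using that by (cases x) simp_all
  show "\<exists>y\<in>carrier planar_group. y \<otimes>\<^bsub>planar_group\<^esub> x = \<one>\<^bsub>planar_group\<^esub>"
    if "x \<in> carrier planar_group" for x
    using that by (auto simp: planar_carrier)
qed (simp_all add: sym_comp_assoc)

lemma flip_div_mod:
  fixes i n s :: nat
  assumes "i < n * s"
  shows "(n * s - 1 - i) div s = n - 1 - i div s" "(n * s - 1 - i) mod s = s - 1 - i mod s"
proof -
  have s: "s > 0" using assms by (cases s) auto
  define q r where "q = i div s" and "r = i mod s"
  have i: "i = q * s + r" by (simp add: q_def r_def)
  have r: "r < s" using s by (simp add: r_def)
  have q: "q < n" using assms by (simp add: q_def less_mult_imp_div_less)
  obtain m where n: "n = q + 1 + m" using q by (metis add.commute less_imp_Suc_add add_Suc_right plus_1_eq_Suc)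
  have "n * s - 1 - i = m * s + (s - 1 - r)"
    using r by (simp add: n i algebra_simps)
  moreover have "s - 1 - r < s" using s by simp
  ultimately show "(n * s - 1 - i) div s = n - 1 - i div s" "(n * s - 1 - i) mod s = s - 1 - i mod s"
    by (simp_all add: n flip: q_def r_def)
qed

lemma rot_map: "rot_ccw (map_mat f A) = map_mat f (rot_ccw A)"
  by (rule eq_matI) (auto simp: rot_ccw_def)

lemma mirror_map: "mirror (map_mat f A) = map_mat f (mirror A)"
  by (rule eq_matI) (auto simp: mirror_def)

lemma rot_pow_map: "(rot_ccw ^^ i) (map_mat f A) = map_mat f ((rot_ccw ^^ i) A)"
  by (induction i) (simp_all add: rot_map)

lemma transform_map: "transform T (map_mat f A) = map_mat f (transform T A)"
  by (cases T) (simp_all add: rot_pow_map mirror_map)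

lemma rot_pow_carrier: "A \<in> carrier_mat n n \<Longrightarrow> (rot_ccw ^^ i) A \<in> carrier_mat n n"
proof (induction i)
  case (Suc i)
  then show ?case by (intro carrier_matI) (simp_all add: carrier_matD[OF Suc.IH])
qed simp

lemma transform_carrier:
  assumes "A \<in> carrier_mat n n"
  shows "transform T A \<in> carrier_mat n n"
  by (cases T) (simp_all add: carrier_matI carrier_matD[OF rot_pow_carrier[OF assms]])

definition planar_conj :: "planar_sym \<Rightarrow> planar_sym \<Rightarrow> planar_sym" where
  "planar_conj T g = T \<otimes>\<^bsub>planar_group\<^esub> g \<otimes>\<^bsub>planar_group\<^esub> inv\<^bsub>planar_group\<^esub> T"

lemma config_act_conj: "config_act T c = transform T (map_mat (map_option (planar_conj T)) c)"
  by (simp add: config_act_def planar_conj_def[abs_def])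

lemma planar_conj_closed:
  "\<lbrakk>T \<in> carrier planar_group; g \<in> carrier planar_group\<rbrakk> \<Longrightarrow> planar_conj T g \<in> carrier planar_group"
  unfolding planar_conj_def by (intro monoid.m_closed group.inv_closed group.is_monoid group_planar)

lemma planar_conj_comp:
  assumes "S \<in> carrier planar_group" "T \<in> carrier planar_group" "g \<in> carrier planar_group"
  shows "planar_conj (S \<otimes>\<^bsub>planar_group\<^esub> T) g = planar_conj S (planar_conj T g)"
proof -
  interpret group planar_group by (rule group_planar)
  show ?thesis using assms unfolding planar_conj_def by (simp only: inv_mult_group m_assoc m_closed inv_closed)
qed

lemma planar_conj_mult:
  assumes "T \<in> carrier planar_group" "g \<in> carrier planar_group"
  shows "planar_conj T g \<otimes>\<^bsub>planar_group\<^esub> T = T \<otimes>\<^bsub>planar_group\<^esub> g"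
proof -
  interpret group planar_group by (rule group_planar)
  show ?thesis using assms unfolding planar_conj_def
    by (simp only: m_assoc m_closed inv_closed l_inv r_one)
qed

lemma transform_conj:
  assumes "T \<in> carrier planar_group" "g \<in> carrier planar_group"
  shows "transform (planar_conj T g) (transform T A) = transform T (transform g A)"
  using planar_conj_mult[OF assms] by (simp flip: transform_comp)

lemma configurations_alt:
  "c \<in> configurations n \<longleftrightarrow> c \<in> carrier_mat n n \<and>
     (\<forall>i<n. \<forall>j<n. \<forall>T. c $$ (i, j) = Some T \<longrightarrow> T \<in> carrier planar_group)"
proof -
  have *: "(x = None \<or> (\<exists>T\<in>S. x = Some T)) \<longleftrightarrow> (\<forall>T. x = Some T \<longrightarrow> T \<in> S)" for x :: "planar_sym option" and S
    by (cases x) auto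
  show ?thesis unfolding configurations_def * by simp
qed

lemma transform_configurations:
  assumes "c \<in> configurations n"
  shows "transform T c \<in> configurations n"
proof -
  have *: "n - Suc i < n" if "i < n" for i using that by simp
  have r: "rot_ccw d \<in> configurations n" if "d \<in> configurations n" for d
    using that unfolding configurations_alt
    by (auto simp: rot_ccw_def) (metis *)
  have m: "mirror d \<in> configurations n" if "d \<in> configurations n" for d
    using that unfolding configurations_alt
    by (auto simp: mirror_def) (metis *)
  have p: "(rot_ccw ^^ i) c \<in> configurations n" for i
    by (induction i) (simp_all add: assms r)
  show ?thesis by (cases T) (simp_all add: p m)
qed

lemma config_act_configurations:
  assumes "T \<in> carrier planar_group" "c \<in> configurations n"
  shows "config_act T c \<in> configurations n"
proof -
  have "map_mat (map_option (planar_conj T)) c \<in> configurations n"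
    using assms(2) unfolding configurations_alt
    by (auto intro!: planar_conj_closed assms(1)) 
  then show ?thesis unfolding config_act_conj by (rule transform_configurations)
qed

lemma config_act_comp:
  assumes "S \<in> carrier planar_group" "T \<in> carrier planar_group" "c \<in> configurations n"
  shows "config_act (S \<otimes>\<^bsub>planar_group\<^esub> T) c = config_act S (config_act T c)"
proof -
  have "map_mat (map_option (planar_conj (S \<otimes>\<^bsub>planar_group\<^esub> T))) c =
        map_mat (map_option (planar_conj S)) (map_mat (map_option (planar_conj T)) c)"
  proof (rule eq_matI, goal_cases)
    case (1 i j)
    then have "\<forall>T. c $$ (i, j) = Some T \<longrightarrow> T \<in> carrier planar_group" "i < dim_row c" "j < dim_col c"
      using assms(3) by (auto simp: configurations_alt)
    then show ?case using planar_conj_comp[OF assms(1,2)] by (cases "c $$ (i, j)") auto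
  qed auto
  then show ?thesis
    unfolding config_act_conj by (simp add: transform_comp transform_map)
qed

lemma generated_carrier:
  "c \<in> carrier_mat n n \<Longrightarrow> generated c k \<in> carrier_mat (n ^ (k + 1)) (n ^ (k + 1))"
  by (cases k) (auto simp: Let_def)

lemma generated_entry:
  assumes "c \<in> carrier_mat n n" "i < n * n ^ (k + 1)" "j < n * n ^ (k + 1)"
  shows "generated c (Suc k) $$ (i, j) = (case c $$ (i div n ^ (k + 1), j div n ^ (k + 1)) of
            None \<Rightarrow> 0
          | Some T \<Rightarrow> transform T (generated c k) $$ (i mod n ^ (k + 1), j mod n ^ (k + 1)))"
  using assms by (simp only: generated.simps Let_def carrier_matD index_mat case_prod_conv)

lemma R1_carrier: "R 1 \<in> carrier planar_group" and K0_carrier: "K 0 \<in> carrier planar_group"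
  by (simp_all add: planar_carrier)

lemma generated_rot:
  assumes c: "c \<in> configurations n"
  shows "generated (config_act (R 1) c) k = rot_ccw (generated c k)"
proof (induction k)
  case 0
  show ?case
    by (rule eq_matI) (use c in \<open>auto simp: config_act_def rot_ccw_def configurations_def\<close>)
next
  case (Suc k)
  let ?d = "config_act (R 1) c" and ?s = "n ^ (k + 1)"
  have cc: "c \<in> carrier_mat n n" using c by (simp add: configurations_def)
  have dc: "?d \<in> carrier_mat n n"
    using config_act_configurations[OF R1_carrier c] by (simp add: configurations_def)
  show ?case
  proof (rule eq_matI, goal_cases)
    case (1 i j)
    then have ij: "i < n * ?s" "j < n * ?s"
      using generated_carrier[OF cc, of "Suc k"] by auto
    have s: "?s > 0" using ij by (cases "?s") auto
    have fl: "n * ?s - 1 - i < n * ?s" using ij(1) by linarith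
    have bl: "i div ?s < n" "j div ?s < n"
      using ij by (simp_all only: less_mult_imp_div_less)
    have d: "?d $$ (i div ?s, j div ?s) = map_option (planar_conj (R 1)) (c $$ (j div ?s, n - 1 - i div ?s))"
      using bl cc by (simp add: config_act_conj rot_ccw_def)
    have "rot_ccw (generated c (Suc k)) $$ (i, j) = generated c (Suc k) $$ (j, n * ?s - 1 - i)"
      using ij generated_carrier[OF cc, of "Suc k"] by (simp add: rot_ccw_def del: generated.simps)
    also have "\<dots> = (case c $$ (j div ?s, n - 1 - i div ?s) of None \<Rightarrow> 0
          | Some T \<Rightarrow> transform T (generated c k) $$ (j mod ?s, ?s - 1 - i mod ?s))"
      by (simp only: generated_entry[OF cc ij(2) fl] flip_div_mod[OF ij(1)])
    also have "\<dots> = (case ?d $$ (i div ?s, j div ?s) of None \<Rightarrow> 0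
          | Some T \<Rightarrow> transform T (generated ?d k) $$ (i mod ?s, j mod ?s))"
    proof (cases "c $$ (j div ?s, n - 1 - i div ?s)")
      case None
      then show ?thesis by (simp only: d option.map option.case)
    next
      case (Some T)
      have "n - 1 - i div ?s < n" using bl by simp
      then have T: "T \<in> carrier planar_group"
        using c bl(2) Some unfolding configurations_alt by metis
      have "transform (planar_conj (R 1) T) (generated ?d k) = rot_ccw (transform T (generated c k))"
        using transform_conj[OF R1_carrier T, of "generated c k"] Suc.IH by simp
      moreover have "transform T (generated c k) \<in> carrier_mat ?s ?s"
        by (intro transform_carrier generated_carrier cc)
      moreover have "i mod ?s < ?s" "j mod ?s < ?s" using s by (simp_all only: mod_less_divisor)
      ultimately show ?thesis
        by (simp only: d Some option.map option.case) (simp add: rot_ccw_def)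
    qed
    also have "\<dots> = generated ?d (Suc k) $$ (i, j)"
      by (rule generated_entry[OF dc ij, symmetric])
    finally show ?case by simp
  qed (use generated_carrier[OF cc, of "Suc k"] generated_carrier[OF dc, of "Suc k"]
        in \<open>auto simp del: generated.simps\<close>)
qed

lemma generated_mirror:
  assumes c: "c \<in> configurations n"
  shows "generated (config_act (K 0) c) k = mirror (generated c k)"
proof (induction k)
  case 0
  show ?case
    by (rule eq_matI) (use c in \<open>auto simp: config_act_def mirror_def configurations_def\<close>)
next
  case (Suc k)
  let ?d = "config_act (K 0) c" and ?s = "n ^ (k + 1)"
  have cc: "c \<in> carrier_mat n n" using c by (simp add: configurations_def)
  have dc: "?d \<in> carrier_mat n n"
    using config_act_configurations[OF K0_carrier c] by (simp add: configurations_def)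
  show ?case
  proof (rule eq_matI, goal_cases)
    case (1 i j)
    then have ij: "i < n * ?s" "j < n * ?s"
      using generated_carrier[OF cc, of "Suc k"] by auto
    have s: "?s > 0" using ij by (cases "?s") auto
    have fl: "n * ?s - 1 - i < n * ?s" using ij(1) by linarith
    have bl: "i div ?s < n" "j div ?s < n"
      using ij by (simp_all only: less_mult_imp_div_less)
    have d: "?d $$ (i div ?s, j div ?s) = map_option (planar_conj (K 0)) (c $$ (n - 1 - i div ?s, j div ?s))"
      using bl cc by (simp add: config_act_conj mirror_def)
    have "mirror (generated c (Suc k)) $$ (i, j) = generated c (Suc k) $$ (n * ?s - 1 - i, j)"
      using ij generated_carrier[OF cc, of "Suc k"] by (simp add: mirror_def del: generated.simps)
    also have "\<dots> = (case c $$ (n - 1 - i div ?s, j div ?s) of None \<Rightarrow> 0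
          | Some T \<Rightarrow> transform T (generated c k) $$ (?s - 1 - i mod ?s, j mod ?s))"
      by (simp only: generated_entry[OF cc fl ij(2)] flip_div_mod[OF ij(1)])
    also have "\<dots> = (case ?d $$ (i div ?s, j div ?s) of None \<Rightarrow> 0
          | Some T \<Rightarrow> transform T (generated ?d k) $$ (i mod ?s, j mod ?s))"
    proof (cases "c $$ (n - 1 - i div ?s, j div ?s)")
      case None
      then show ?thesis by (simp only: d option.map option.case)
    next
      case (Some T)
      have "n - 1 - i div ?s < n" using bl by simp
      then have T: "T \<in> carrier planar_group"
        using c bl(2) Some unfolding configurations_alt by metis
      have "transform (planar_conj (K 0) T) (generated ?d k) = mirror (transform T (generated c k))"
        using transform_conj[OF K0_carrier T, of "generated c k"] Suc.IH by simp
      moreover have "transform T (generated c k) \<in> carrier_mat ?s ?s"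
        by (intro transform_carrier generated_carrier cc)
      moreover have "i mod ?s < ?s" "j mod ?s < ?s" using s by (simp_all only: mod_less_divisor)
      ultimately show ?thesis
        by (simp only: d Some option.map option.case) (simp add: mirror_def)
    qed
    also have "\<dots> = generated ?d (Suc k) $$ (i, j)"
      by (rule generated_entry[OF dc ij, symmetric])
    finally show ?case by simp
  qed (use generated_carrier[OF cc, of "Suc k"] generated_carrier[OF dc, of "Suc k"]
        in \<open>auto simp del: generated.simps\<close>)
qed

lemma planar_generators [consumes 1, case_names one rot mirror]:
  assumes T: "T \<in> carrier planar_group" and one: "P (R 0)"
    and rot: "\<And>S. S \<in> carrier planar_group \<Longrightarrow> P S \<Longrightarrow> P (R 1 \<otimes>\<^bsub>planar_group\<^esub> S)"
    and mir: "\<And>S. S \<in> carrier planar_group \<Longrightarrow> P S \<Longrightarrow> P (K 0 \<otimes>\<^bsub>planar_group\<^esub> S)"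
  shows "P T"
proof -
  have 1: "P (R 1)" using rot[OF _ one] by (simp add: planar_carrier)
  have 2: "P (R 2)" using rot[OF _ 1] by (simp add: planar_carrier numeral_2_eq_2)
  have 3: "P (R 3)" using rot[OF _ 2] by (simp add: planar_carrier)
  have "P (K 0)" using mir[OF _ one] by simp
  moreover have "P (K 1)" using mir[OF _ 1] by simp
  moreover have "P (K 2)" using mir[OF _ 2] by (simp add: numeral_2_eq_2)
  moreover have "P (K 3)" using mir[OF _ 3] by simp
  ultimately show ?thesis using T one 1 2 3 unfolding planar_carrier by blast
qed

lemma config_act_one: "c \<in> configurations n \<Longrightarrow> config_act (R 0) c = c"
proof -
  assume c: "c \<in> configurations n"
  interpret group planar_group by (rule group_planar)
  have "planar_conj (R 0) g = g" if "g \<in> carrier planar_group" for g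
  proof -
    have "inv\<^bsub>planar_group\<^esub> (R 0) = R 0" using inv_one by simp
    then show ?thesis using that l_one[OF that] r_one[OF that] by (simp add: planar_conj_def)
  qed
  then have "\<forall>T. x = Some T \<longrightarrow> T \<in> carrier planar_group \<Longrightarrow> map_option (planar_conj (R 0)) x = x" for x
    by (cases x) auto
  then show ?thesis using c
    by (intro eq_matI) (auto simp: config_act_conj configurations_alt)
qed

lemma generated_config_act:
  assumes "T \<in> carrier planar_group" "c \<in> configurations n"
  shows "generated (config_act T c) k = transform T (generated c k)"
  using assms(1)
proof (induction T rule: planar_generators)
  case one
  show ?case using assms(2) by (simp add: config_act_one)
next
  case (rot S)
  have "generated (config_act (R 1 \<otimes>\<^bsub>planar_group\<^esub> S) c) k = generated (config_act (R 1) (config_act S c)) k"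
    by (simp only: config_act_comp[OF R1_carrier rot(1) assms(2)])
  also have "\<dots> = transform (R 1) (transform S (generated c k))"
    using generated_rot[OF config_act_configurations[OF rot(1) assms(2)], of k] rot(2) by simp
  finally show ?case by (simp only: transform_comp planar_group_simps)
next
  case (mirror S)
  have "generated (config_act (K 0 \<otimes>\<^bsub>planar_group\<^esub> S) c) k = generated (config_act (K 0) (config_act S c)) k"
    by (simp only: config_act_comp[OF K0_carrier mirror(1) assms(2)])
  also have "\<dots> = transform (K 0) (transform S (generated c k))"
    using generated_mirror[OF config_act_configurations[OF mirror(1) assms(2)], of k] mirror(2) by simp
  finally show ?case by (simp only: transform_comp planar_group_simps)
qed

lemma one_zero_configs_act:
  assumes "T \<in> carrier planar_group" "c \<in> one_zero_configs"
  shows "config_act T c \<in> one_zero_configs"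
proof -
  define z :: "planar_sym option mat \<Rightarrow> nat \<Rightarrow> nat \<Rightarrow> nat"
    where "z d i j = of_bool (d $$ (i, j) = None)" for d i j
  have count: "card {(i, j). i < 2 \<and> j < 2 \<and> d $$ (i, j) = None} =
     z d 0 0 + z d 0 1 + z d 1 0 + z d 1 1" for d
  proof -
    have "{(i, j). i < 2 \<and> j < 2 \<and> d $$ (i, j) = None} = ({..<2} \<times> {..<2}) \<inter> {p. d $$ p = None}"
      by (simp only: set_eq_iff split_paired_all) simp
    also have "card \<dots> = (\<Sum>p\<in>{..<2} \<times> {..<2}. of_bool (d $$ p = None))"
      using sum_of_bool_eq[of "{..<2::nat} \<times> {..<2::nat}" "\<lambda>p. d $$ p = None", where 'a = nat]
      by (simp only: finite_cartesian_product finite_lessThan of_nat_id)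
    also have "\<dots> = (\<Sum>i<2. \<Sum>j<2. z d i j)"
      by (simp only: sum.cartesian_product z_def case_prod_unfold prod.collapse)
    also have "\<dots> = z d 0 0 + z d 0 1 + z d 1 0 + z d 1 1"
      by (simp only: numeral_2_eq_2 sum.lessThan_Suc lessThan_0 sum.empty One_nat_def add_0 add.assoc)
    finally show ?thesis .
  qed
  have r: "config_act (R 1) d \<in> one_zero_configs" and m: "config_act (K 0) d \<in> one_zero_configs"
    if d: "d \<in> one_zero_configs" for d
  proof -
    have dc: "d \<in> configurations 2" and dim: "dim_row d = 2" "dim_col d = 2"
      using d by (auto simp: one_zero_configs_def configurations_def)
    have "z (config_act (R 1) d) i j = z d j (1 - i)" "z (config_act (K 0) d) i j = z d (1 - i) j"
      if "i < 2" "j < 2" for i j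
      using that dim by (simp_all add: z_def config_act_conj rot_ccw_def mirror_def)
    from this[of 0 0] this[of 0 1] this[of 1 0] this[of 1 1]
    have zr: "z (config_act (R 1) d) 0 0 = z d 0 1" "z (config_act (R 1) d) 0 1 = z d 1 1"
        "z (config_act (R 1) d) 1 0 = z d 0 0" "z (config_act (R 1) d) 1 1 = z d 1 0"
      and zm: "z (config_act (K 0) d) 0 0 = z d 1 0" "z (config_act (K 0) d) 0 1 = z d 1 1"
        "z (config_act (K 0) d) 1 0 = z d 0 0" "z (config_act (K 0) d) 1 1 = z d 0 1"
      by simp_all
    have "z d 0 0 + z d 0 1 + z d 1 0 + z d 1 1 = 1"
      using d unfolding one_zero_configs_def mem_Collect_eq count by blast
    then show "config_act (R 1) d \<in> one_zero_configs" "config_act (K 0) d \<in> one_zero_configs"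
      using config_act_configurations[OF R1_carrier dc] config_act_configurations[OF K0_carrier dc]
      unfolding one_zero_configs_def mem_Collect_eq count zr zm by linarith+
  qed
  have c: "c \<in> configurations 2" using assms(2) by (simp add: one_zero_configs_def)
  show ?thesis using assms(1)
  proof (induction T rule: planar_generators)
    case one
    show ?case using assms(2) c by (simp add: config_act_one)
  next
    case (rot S)
    then show ?case by (simp only: config_act_comp[OF R1_carrier rot(1) c] r)
  next
    case (mirror S)
    then show ?case by (simp only: config_act_comp[OF K0_carrier mirror(1) c] m)
  qed
qed

lemma equiv_identical: "equiv one_zero_configs identical"
  by (rule equivI) (auto simp: refl_on_def sym_def trans_def identical_def)

lemma identical_act:
  "T \<in> carrier planar_group \<Longrightarrow> (c, d) \<in> identical \<Longrightarrow> (config_act T c, config_act T d) \<in> identical"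
  unfolding identical_def
  using generated_config_act[of T _ 2] one_zero_configs_act[of T]
  by (auto simp: one_zero_configs_def)

lemma config_act_inv:
  assumes "T \<in> carrier planar_group" "c \<in> configurations n"
  shows "config_act (inv\<^bsub>planar_group\<^esub> T) (config_act T c) = c"
    "config_act T (config_act (inv\<^bsub>planar_group\<^esub> T) c) = c"
proof -
  interpret group planar_group by (rule group_planar)
  have i: "inv\<^bsub>planar_group\<^esub> T \<in> carrier planar_group" using assms(1) by (rule inv_closed)
  show "config_act (inv\<^bsub>planar_group\<^esub> T) (config_act T c) = c"
    using config_act_comp[OF i assms] l_inv[OF assms(1)] config_act_one[OF assms(2)] by simp
  show "config_act T (config_act (inv\<^bsub>planar_group\<^esub> T) c) = c"
    using config_act_comp[OF assms(1) i assms(2)] r_inv[OF assms(1)] config_act_one[OF assms(2)] by simp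
qed

lemma config_act_class:
  assumes T: "T \<in> carrier planar_group" and c: "c \<in> one_zero_configs"
  shows "config_act T ` (identical `` {c}) = identical `` {config_act T c}"
proof
  show "config_act T ` (identical `` {c}) \<subseteq> identical `` {config_act T c}"
    using identical_act[OF T] by auto
  interpret group planar_group by (rule group_planar)
  let ?i = "inv\<^bsub>planar_group\<^esub> T"
  have conf: "x \<in> configurations 2" if "x \<in> one_zero_configs" for x
    using that by (simp add: one_zero_configs_def)
  show "identical `` {config_act T c} \<subseteq> config_act T ` (identical `` {c})"
  proof
    fix d assume "d \<in> identical `` {config_act T c}"
    then have d: "(config_act T c, d) \<in> identical" by simp
    then have "d \<in> one_zero_configs" by (simp add: identical_def)
    then have "d = config_act T (config_act ?i d)"
      using config_act_inv(2)[OF T conf] by simp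
    moreover have "(c, config_act ?i d) \<in> identical"
      using identical_act[OF inv_closed[OF T] d] config_act_inv(1)[OF T conf[OF c]] by simp
    ultimately show "d \<in> config_act T ` (identical `` {c})" by blast
  qed
qed

lemma class_act_class:
  assumes "T \<in> carrier planar_group" "c \<in> one_zero_configs"
  shows "class_act T (identical `` {c}) = identical `` {config_act T c}"
  using assms by (simp add: class_act_def E2_def quotientI config_act_class)

lemma group_action_E2: "group_action planar_group E2 class_act"
proof -
  interpret group planar_group by (rule group_planar)
  have closed: "class_act T X \<in> E2" if T: "T \<in> carrier planar_group" and X: "X \<in> E2" for T X
  proof -
    obtain c where c: "c \<in> one_zero_configs" "X = identical `` {c}"
      using X unfolding E2_def by (rule quotientE)
    have "class_act T X = identical `` {config_act T c}"
      using class_act_class[OF T c(1)] by (simp only: c(2))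
    then show ?thesis
      using quotientI[OF one_zero_configs_act[OF T c(1)]] by (simp only: E2_def)
  qed
  have comp: "class_act (S \<otimes>\<^bsub>planar_group\<^esub> T) X = class_act S (class_act T X)"
    if S: "S \<in> carrier planar_group" and T: "T \<in> carrier planar_group" and X: "X \<in> E2" for S T X
  proof -
    obtain c where c: "c \<in> one_zero_configs" "X = identical `` {c}"
      using X unfolding E2_def by (rule quotientE)
    have "c \<in> configurations 2" using c(1) by (simp add: one_zero_configs_def)
    then show ?thesis
      using class_act_class[OF m_closed[OF S T] c(1)] class_act_class[OF T c(1)]
        class_act_class[OF S one_zero_configs_act[OF T c(1)]] config_act_comp[OF S T]
      by (simp only: c(2))
  qed
  have one: "class_act \<one>\<^bsub>planar_group\<^esub> X = X" if X: "X \<in> E2" for X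
  proof -
    obtain c where c: "c \<in> one_zero_configs" "X = identical `` {c}"
      using X unfolding E2_def by (rule quotientE)
    have "config_act \<one>\<^bsub>planar_group\<^esub> c = c"
      using c(1) config_act_one[of c 2] by (simp add: one_zero_configs_def)
    then show ?thesis using class_act_class[OF one_closed c(1)] by (simp only: c(2))
  qed
  have bij: "class_act T \<in> Bij E2" if T: "T \<in> carrier planar_group" for T
  proof -
    note i = inv_closed[OF T]
    have "bij_betw (class_act T) E2 E2"
    proof (rule bij_betwI[where g = "class_act (inv\<^bsub>planar_group\<^esub> T)"])
      show "class_act (inv\<^bsub>planar_group\<^esub> T) (class_act T X) = X" if "X \<in> E2" for X
        using comp[OF i T that] one[OF that] l_inv[OF T] by (simp only:)
      show "class_act T (class_act (inv\<^bsub>planar_group\<^esub> T) X) = X" if "X \<in> E2" for X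
        using comp[OF T i that] one[OF that] r_inv[OF T] by (simp only:)
    qed (auto intro: closed[OF T] closed[OF i])
    moreover have "class_act T \<in> extensional E2" by (simp add: class_act_def)
    ultimately show ?thesis by (simp add: Bij_def)
  qed
  have "class_act \<in> hom planar_group (BijGroup E2)"
  proof (rule homI)
    show "class_act T \<in> carrier (BijGroup E2)" if "T \<in> carrier planar_group" for T
      using bij[OF that] by (simp add: BijGroup_def)
    show "class_act (S \<otimes>\<^bsub>planar_group\<^esub> T) = class_act S \<otimes>\<^bsub>BijGroup E2\<^esub> class_act T"
      if S: "S \<in> carrier planar_group" and T: "T \<in> carrier planar_group" for S T
    proof
      fix X
      show "class_act (S \<otimes>\<^bsub>planar_group\<^esub> T) X = (class_act S \<otimes>\<^bsub>BijGroup E2\<^esub> class_act T) X"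
      proof (cases "X \<in> E2")
        case True
        then show ?thesis using comp[OF S T True] bij[OF S] bij[OF T]
          by (simp add: BijGroup_def compose_def del: planar_group_simps)
      next
        case False
        then show ?thesis using bij[OF S] bij[OF T]
          by (simp add: BijGroup_def compose_def class_act_def del: planar_group_simps)
      qed
    qed
  qed
  then show ?thesis
    by (intro group_action.intro group_hom.intro group_hom_axioms.intro group_planar group_BijGroup)
qed

end

theory Submission
  imports Defs
begin

text \<open>A rotation moves the zero entry to the upper left corner, so every orbit is represented by a triple
  in \<open>G\<^sup>3\<close> of the remaining entries. Since the corner is visible in \<open>M\<^sub>0\<close>, only \<open>R 0\<close> and the
  transpose \<open>K 1\<close> can map such a pattern to another one, and an element of \<open>G\<close> fixing all \<open>M\<^sub>k\<close> is one of
  these two. If some \<open>M\<^sub>k\<close> is not symmetric, then the blocks determine the triple, and its orbit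
  contains exactly two triples, exchanged by \<open>K 1\<close>. If all \<open>M\<^sub>k\<close> are symmetric, then each entry
  matters only modulo right multiplication by \<open>K 1\<close>, and the orbit contains exactly \<open>2\<^sup>3\<close> triples.
  Symmetry holds for 64 of the 512 triples, whence \<open>448 / 2 + 64 / 8 = 232\<close> orbits.\<close>

section \<open>Block decomposition of the generated matrices\<close>

abbreviation syms :: "planar_sym set" where
  "syms \<equiv> carrier planar_group"

text \<open>The symbol 0 becomes a zero matrix of the size of \<open>M\<^sub>k\<close>, so that
  blocks at all positions have equal dimensions and can be compared as matrices.\<close>

definition block :: "planar_sym option mat \<Rightarrow> nat \<Rightarrow> nat \<times> nat \<Rightarrow> nat mat" where
  "block c k p = (case c $$ p of
      None \<Rightarrow> 0\<^sub>m (dim_row c ^ (k + 1)) (dim_row c ^ (k + 1))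
    | Some T \<Rightarrow> transform T (generated c k))"

lemma block_carrier:
  "c \<in> carrier_mat n n \<Longrightarrow> block c k p \<in> carrier_mat (n ^ (k + 1)) (n ^ (k + 1))"
  using transform_carrier[OF generated_carrier, of c n] by (auto simp: block_def split: option.split)

lemma generated_block_entry:
  assumes c: "c \<in> carrier_mat n n" and ij: "i < n * n ^ (k + 1)" "j < n * n ^ (k + 1)"
  shows "generated c (Suc k) $$ (i, j) =
    block c k (i div n ^ (k + 1), j div n ^ (k + 1)) $$ (i mod n ^ (k + 1), j mod n ^ (k + 1))"
proof -
  have "n ^ (k + 1) > 0" using ij by (cases n) auto
  then show ?thesis
    unfolding generated_entry[OF c ij] using c by (auto simp: block_def split: option.split)
qed

text \<open>With block size s, each index is uniquely \<open>p * s + r\<close> with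
  \<open>r < s\<close>; \<open>div\<close> and \<open>mod\<close> by s recover the block and the
  entry within it.\<close>

lemma generated_Suc_eq_iff:
  assumes c: "c \<in> carrier_mat n n" and d: "d \<in> carrier_mat n n"
  shows "generated c (Suc k) = generated d (Suc k) \<longleftrightarrow>
    (\<forall>i<n. \<forall>j<n. block c k (i, j) = block d k (i, j))"
proof (intro iffI allI impI)
  let ?s = "n ^ (k + 1)"
  fix i j assume eq: "generated c (Suc k) = generated d (Suc k)" and ij: "i < n" "j < n"
  show "block c k (i, j) = block d k (i, j)"
  proof (rule eq_matI, goal_cases)
    case (1 u v)
    then have uv: "u < ?s" "v < ?s" using carrier_matD[OF block_carrier[OF d]] by simp_all
    have lt: "p * ?s + r < n * ?s" if "p < n" "r < ?s" for p r
    proof -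
      have "p * ?s + r < (p + 1) * ?s" using that by simp
      also have "\<dots> \<le> n * ?s" using that by (intro mult_right_mono) auto
      finally show ?thesis .
    qed
    have dm: "(p * m + r) div m = p" "(p * m + r) mod m = r" if "r < m" for p r m :: nat
      using that by auto
    note e = generated_block_entry[where k = k, OF _ lt[OF ij(1) uv(1)] lt[OF ij(2) uv(2)],
        unfolded dm[OF uv(1)] dm[OF uv(2)]]
    show ?case using e[OF c] e[OF d] eq by simp
  qed (simp_all add: carrier_matD[OF block_carrier[OF c]] carrier_matD[OF block_carrier[OF d]])
next
  let ?s = "n ^ (k + 1)"
  assume bl: "\<forall>i<n. \<forall>j<n. block c k (i, j) = block d k (i, j)"
  note gc = generated_carrier[OF c, of "Suc k"] and gd = generated_carrier[OF d, of "Suc k"]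
  show "generated c (Suc k) = generated d (Suc k)"
  proof (rule eq_matI, goal_cases)
    case (1 i j)
    then have ij: "i < n * ?s" "j < n * ?s" using gd by auto
    have "i div ?s < n" "j div ?s < n" using ij by (simp_all add: less_mult_imp_div_less)
    then show ?case
      unfolding generated_block_entry[OF c ij] generated_block_entry[OF d ij] using bl by simp
  qed (use gc gd in \<open>auto simp del: generated.simps\<close>)
qed

lemma transform_left_cancel:
  assumes "T \<in> syms"
  shows "transform T A = transform T B \<longleftrightarrow> A = B"
proof
  interpret group planar_group by (rule group_planar)
  assume "transform T A = transform T B"
  then have "transform (sym_comp (inv\<^bsub>planar_group\<^esub> T) T) A = transform (sym_comp (inv\<^bsub>planar_group\<^esub> T) T) B"
    by (simp only: transform_comp)
  then show "A = B" using l_inv[OF assms] by simp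
qed simp

section \<open>Triples as patterns with the zero in the upper left corner\<close>

definition corner_config :: "planar_sym \<times> planar_sym \<times> planar_sym \<Rightarrow> planar_sym option mat" where
  "corner_config = (\<lambda>(a, b, e). mat 2 2 (\<lambda>(i, j).
     if i = 0 then (if j = 0 then None else Some a) else Some (if j = 0 then b else e)))"

lemma corner_config_carrier: "corner_config x \<in> carrier_mat 2 2"
  by (simp add: corner_config_def split: prod.split)

lemma corner_config_dim [simp]:
  "dim_row (corner_config x) = 2" "dim_col (corner_config x) = 2"
  using corner_config_carrier[of x] by auto

lemma corner_config_index [simp]:
  "corner_config (a, b, e) $$ (0, 0) = None" "corner_config (a, b, e) $$ (0, Suc 0) = Some a"
  "corner_config (a, b, e) $$ (Suc 0, 0) = Some b" "corner_config (a, b, e) $$ (Suc 0, Suc 0) = Some e"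
  by (simp_all add: corner_config_def)

lemma all_less_2: "(\<forall>i<2. P i) \<longleftrightarrow> P 0 \<and> P (Suc 0)" for P :: "nat \<Rightarrow> bool"
  by (auto simp: less_2_cases_iff)

lemma corner_config_one_zero:
  assumes "x \<in> syms \<times> syms \<times> syms"
  shows "corner_config x \<in> one_zero_configs"
proof -
  obtain a b e where x: "x = (a, b, e)" by (cases x)
  have "{(i, j). i < 2 \<and> j < 2 \<and> corner_config x $$ (i, j) = None} = {(0, 0)}"
    by (auto simp: x less_2_cases_iff)
  then show ?thesis
    using assms corner_config_carrier[of x]
    by (simp add: one_zero_configs_def configurations_alt all_less_2 x)
qed

lemma corner_configI:
  assumes "c \<in> one_zero_configs" "c $$ (0, 0) = None"
  shows "c \<in> corner_config ` (syms \<times> syms \<times> syms)"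
proof -
  let ?Z = "{(i, j). i < 2 \<and> j < 2 \<and> c $$ (i, j) = None}"
  have cm: "c \<in> carrier_mat 2 2"
    and conf: "\<And>i j T. i < 2 \<Longrightarrow> j < 2 \<Longrightarrow> c $$ (i, j) = Some T \<Longrightarrow> T \<in> syms"
    using assms(1) by (auto simp: one_zero_configs_def configurations_alt)
  have "card ?Z = 1" using assms(1) by (simp add: one_zero_configs_def)
  then obtain z where "?Z = {z}" by (rule card_1_singletonE)
  moreover have "(0, 0) \<in> ?Z" using assms(2) by simp
  ultimately have Z: "?Z = {(0, 0)}" by simp
  have some: "\<exists>T\<in>syms. c $$ (i, j) = Some T" if "i < 2" "j < 2" "(i, j) \<noteq> (0, 0)" for i j
  proof (cases "c $$ (i, j)")
    case None
    then have "(i, j) \<in> ?Z" using that by blast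
    then show ?thesis using that(3) by (simp only: Z singleton_iff)
  next
    case (Some T)
    then show ?thesis using conf[OF that(1,2)] by blast
  qed
  obtain a b e where abe: "a \<in> syms" "b \<in> syms" "e \<in> syms"
    "c $$ (0, Suc 0) = Some a" "c $$ (Suc 0, 0) = Some b" "c $$ (Suc 0, Suc 0) = Some e"
    using some[of 0 "Suc 0"] some[of "Suc 0" 0] some[of "Suc 0" "Suc 0"] by auto
  have "c = corner_config (a, b, e)"
    using cm abe assms(2) by (intro eq_matI) (auto simp: less_2_cases_iff)
  then show ?thesis using abe by blast
qed

text \<open>The zero blocks agree automatically. This is the step of the inductions on k;
  \<open>corner_config_generated_0\<close> is their start.\<close>

lemma corner_config_generated_Suc_eq:
  "generated (corner_config (a, b, e)) (Suc k) = generated (corner_config (a', b', e')) (Suc k) \<longleftrightarrow>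
     (let M = generated (corner_config (a, b, e)) k; M' = generated (corner_config (a', b', e')) k in
      transform a M = transform a' M' \<and> transform b M = transform b' M' \<and>
      transform e M = transform e' M')"
  unfolding generated_Suc_eq_iff[OF corner_config_carrier corner_config_carrier]
  by (auto simp: all_less_2 block_def Let_def)

lemma corner_config_generated_0: "generated (corner_config x) 0 = generated (corner_config y) 0"
  by (rule eq_matI) (cases x; cases y; auto simp: less_2_cases_iff)+

text \<open>Both initial tiles have their only 0 at the corner, so \<open>T\<close> must keep the
  corner in place. This limits both coincidences between triples and motions within an
  orbit.\<close>

lemma corner_config_stabilizer:
  assumes "T \<in> syms" "transform T (generated (corner_config x) 0) = generated (corner_config y) 0"
  shows "T \<in> {R 0, K 1}"
proof -
  let ?A = "generated (corner_config x) 0"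
  obtain a b e where x: "x = (a, b, e)" by (cases x)
  have "transform T ?A = ?A"
    using assms(2) by (simp only: corner_config_generated_0[of y x])
  \<comment> \<open>This one entry suffices: the other six elements bring a 1 to the corner.\<close>
  then have "transform T ?A $$ (0, 0) = 0"
    by (simp add: x)
  moreover have "?A = mat 2 2 (\<lambda>p. if p = (0, 0) then 0 else 1)"
    by (rule eq_matI) (auto simp: x less_2_cases_iff)
  ultimately show ?thesis
    using assms(1) by (auto simp: planar_carrier rot_ccw_def mirror_def numeral_2_eq_2 numeral_3_eq_3)
qed


section \<open>Diagonal symmetry and identical triples\<close>

definition diag_symmetric :: "planar_sym \<times> planar_sym \<times> planar_sym \<Rightarrow> bool" where
  "diag_symmetric x \<longleftrightarrow>
     (\<forall>k. transform (K 1) (generated (corner_config x) k) = generated (corner_config x) k)"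

text \<open>A product of three left cosets of the subgroup generated by the transpose. For a
  symmetric pattern these are exactly the triples generating the same matrices.\<close>

definition diag_cosets :: "planar_sym \<times> planar_sym \<times> planar_sym \<Rightarrow> (planar_sym \<times> planar_sym \<times> planar_sym) set"
  where "diag_cosets = (\<lambda>(a, b, e).
     {a, sym_comp a (K 1)} \<times> {b, sym_comp b (K 1)} \<times> {e, sym_comp e (K 1)})"

text \<open>The action of \<open>K 1\<close> on triples, as \<open>config_act_corner\<close>
  confirms: transposing exchanges the two off-diagonal positions.\<close>

definition reflect :: "planar_sym \<times> planar_sym \<times> planar_sym \<Rightarrow> planar_sym \<times> planar_sym \<times> planar_sym"
  where "reflect = (\<lambda>(a, b, e).
     (planar_conj (K 1) b, planar_conj (K 1) a, planar_conj (K 1) e))"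

lemma K1_carrier: "K 1 \<in> syms"
  by simp

lemma planar_conj_K1: "planar_conj (K 1) g = sym_comp (sym_comp (K 1) g) (K 1)"
proof -
  have "inv\<^bsub>planar_group\<^esub> (K 1) = K 1"
    by (rule group.inv_equality[OF group_planar]) simp_all
  then show ?thesis by (simp add: planar_conj_def)
qed

lemma reflect_closed: "x \<in> syms \<times> syms \<times> syms \<Longrightarrow> reflect x \<in> syms \<times> syms \<times> syms"
  using planar_conj_closed[OF K1_carrier] by (auto simp: reflect_def)

lemma config_act_corner: "config_act (K 1) (corner_config x) = corner_config (reflect x)"
proof -
  obtain a b e where x: "x = (a, b, e)" by (cases x)
  show ?thesis unfolding config_act_conj transform_K1
    by (rule eq_matI) (auto simp: x reflect_def less_2_cases_iff)
qed

lemma generated_reflect: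
  assumes "x \<in> syms \<times> syms \<times> syms"
  shows "generated (corner_config (reflect x)) k = transform (K 1) (generated (corner_config x) k)"
  using generated_config_act[OF K1_carrier, of "corner_config x" 2 k] corner_config_one_zero[OF assms]
  by (simp only: config_act_corner one_zero_configs_def mem_Collect_eq)

lemma transform_K1_K1: "transform (K 1) (transform (K 1) A) = A"
  by (simp only: transform_K1 transpose_transpose)

lemma diag_symmetric_reflect:
  assumes "x \<in> syms \<times> syms \<times> syms"
  shows "diag_symmetric (reflect x) \<longleftrightarrow> diag_symmetric x"
  unfolding diag_symmetric_def generated_reflect[OF assms] transform_K1_K1 by metis

text \<open>The quotient \<open>u = g\<inverse> h\<close> fixes every \<open>M\<^sub>k\<close>.
  Already k = 0 forces u to be \<open>R 0\<close> or \<open>K 1\<close>, and in the latter case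
  being fixed for all k is symmetry.\<close>

lemma transform_generated_eqD:
  assumes g: "g \<in> syms" and h: "h \<in> syms"
    and eq: "\<And>k. transform g (generated (corner_config x) k) = transform h (generated (corner_config x) k)"
  shows "h = g \<or> h = sym_comp g (K 1) \<and> diag_symmetric x"
proof -
  interpret group planar_group by (rule group_planar)
  let ?i = "inv\<^bsub>planar_group\<^esub> g"
  let ?u = "sym_comp ?i h"
  have u: "?u \<in> syms" using m_closed[OF inv_closed[OF g] h] by (simp only: planar_group_simps)
  have "g \<otimes>\<^bsub>planar_group\<^esub> (?i \<otimes>\<^bsub>planar_group\<^esub> h) = h"
    by (metis g h inv_closed l_one m_assoc r_inv)
  then have h_eq: "h = sym_comp g ?u" by (simp only: planar_group_simps)
  have fixed: "transform ?u (generated (corner_config x) k) = generated (corner_config x) k" for k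
    using eq[of k] transform_left_cancel[OF g] h_eq by (metis transform_comp)
  have "?u \<in> {R 0, K 1}" using corner_config_stabilizer[OF u fixed] .
  then show ?thesis
  proof (elim insertE emptyE)
    assume "?u = R 0"
    then have "h = g" using h_eq r_one[OF g] by (metis planar_group_simps)
    then show ?thesis ..
  next
    assume "?u = K 1"
    then show ?thesis using h_eq fixed unfolding diag_symmetric_def by metis
  qed
qed

text \<open>Corresponding entries can be compared one at a time, and a single differing entry
  already forces symmetry.\<close>

lemma generated_eq_imp:
  assumes x: "x \<in> syms \<times> syms \<times> syms" and y: "y \<in> syms \<times> syms \<times> syms"
    and eq: "\<And>k. generated (corner_config x) k = generated (corner_config y) k"
  shows "y \<in> diag_cosets x" "y = x \<or> diag_symmetric x"
proof -
  obtain a b e a' b' e' where xy: "x = (a, b, e)" "y = (a', b', e')" by (cases x; cases y)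
  \<comment> \<open>Equality at \<open>Suc k\<close> equates the blocks, and equality at k makes
    them transforms of one and the same matrix.\<close>
  have c: "transform a (generated (corner_config x) k) = transform a' (generated (corner_config x) k)"
    "transform b (generated (corner_config x) k) = transform b' (generated (corner_config x) k)"
    "transform e (generated (corner_config x) k) = transform e' (generated (corner_config x) k)" for k
    using eq[of "Suc k"] eq[of k] unfolding xy corner_config_generated_Suc_eq by (simp_all add: Let_def)
  have m: "a \<in> syms" "b \<in> syms" "e \<in> syms" "a' \<in> syms" "b' \<in> syms" "e' \<in> syms"
    using x y by (simp_all only: xy mem_Sigma_iff)
  have "a' = a \<or> a' = sym_comp a (K 1) \<and> diag_symmetric x"
    "b' = b \<or> b' = sym_comp b (K 1) \<and> diag_symmetric x"
    "e' = e \<or> e' = sym_comp e (K 1) \<and> diag_symmetric x"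
    by (rule transform_generated_eqD[OF _ _ c(1)] transform_generated_eqD[OF _ _ c(2)]
        transform_generated_eqD[OF _ _ c(3)], (rule m)+)+
  then show "y \<in> diag_cosets x" "y = x \<or> diag_symmetric x"
    by (auto simp: xy diag_cosets_def)
qed

text \<open>In \<open>sym_comp g (K 1)\<close> the factor \<open>K 1\<close> acts first, and
  \<open>A\<close> absorbs it.\<close>

lemma transform_diag_coset:
  assumes "transform (K 1) A = A" "h \<in> {g, sym_comp g (K 1)}"
  shows "transform h A = transform g A"
  using assms by (auto simp: transform_comp simp del: transform.simps)

lemma generated_diag_cosets:
  assumes sym: "diag_symmetric x" and y: "y \<in> diag_cosets x"
  shows "generated (corner_config y) k = generated (corner_config x) k"
proof (induction k)
  case 0
  show ?case by (rule corner_config_generated_0)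
next
  case (Suc k)
  obtain a b e a' b' e' where xy: "x = (a, b, e)" "y = (a', b', e')" by (cases x; cases y)
  have "transform (K 1) (generated (corner_config x) k) = generated (corner_config x) k"
    using sym by (simp only: diag_symmetric_def)
  note coset = transform_diag_coset[OF this]
  show ?case
    using y Suc unfolding xy corner_config_generated_Suc_eq Let_def diag_cosets_def
    by (simp only: coset[unfolded xy] prod.case mem_Times_iff fst_conv snd_conv)
qed

text \<open>The pattern is symmetric iff the configuration and its reflection generate the same matrices, which
  turns symmetry of all \<open>M\<^sub>k\<close> into a finite condition on the entries.\<close>

lemma diag_symmetric_iff:
  assumes x: "x \<in> syms \<times> syms \<times> syms"
  shows "diag_symmetric x \<longleftrightarrow> reflect x \<in> diag_cosets x"
proof
  assume "diag_symmetric x"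
  then show "reflect x \<in> diag_cosets x"
    using generated_reflect[OF x] by (intro generated_eq_imp x reflect_closed) (simp only: diag_symmetric_def)
next
  assume r: "reflect x \<in> diag_cosets x"
  have "generated (corner_config (reflect x)) k = generated (corner_config x) k" for k
  proof (induction k)
    case 0
    show ?case by (rule corner_config_generated_0)
  next
    case (Suc k)
    obtain a b e a' b' e' where xy: "x = (a, b, e)" "reflect x = (a', b', e')"
      by (cases x; cases "reflect x")
    \<comment> \<open>As \<open>reflect x\<close> generates the transposes, the induction hypothesis
      says that this \<open>M\<^sub>k\<close> is symmetric. Appealing to
      \<open>generated_diag_cosets\<close> would be circular, since it assumes symmetry at all
      levels.\<close>
    have "transform (K 1) (generated (corner_config x) k) = generated (corner_config x) k"
      using Suc by (simp only: generated_reflect[OF x])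
    note coset = transform_diag_coset[OF this]
    show ?case
      using r Suc unfolding xy(2) unfolding xy(1) corner_config_generated_Suc_eq Let_def diag_cosets_def
      by (simp only: coset[unfolded xy] prod.case mem_Times_iff fst_conv snd_conv)
  qed
  then show "diag_symmetric x"
    unfolding diag_symmetric_def generated_reflect[OF x] by blast
qed

section \<open>Orbits of classes in terms of triples\<close>

lemma (in group_action) orbit_eq_iff:
  assumes "x \<in> E" "y \<in> E"
  shows "orbit G \<phi> x = orbit G \<phi> y \<longleftrightarrow> y \<in> orbit G \<phi> x"
proof
  assume "orbit G \<phi> x = orbit G \<phi> y"
  then show "y \<in> orbit G \<phi> x" using orbit_refl[OF assms(2)] by simp
next
  have sub: "orbit G \<phi> z \<subseteq> E" if "z \<in> E" for z
    using element_image[OF _ that] by (auto simp: orbit_def)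
  assume y: "y \<in> orbit G \<phi> x"
  show "orbit G \<phi> x = orbit G \<phi> y"
    using orbit_trans[OF assms _ y] orbit_trans[OF assms(2,1) _ orbit_sym[OF assms y]]
      sub[OF assms(1)] sub[OF assms(2)] by blast
qed

definition corner_orbit :: "planar_sym \<times> planar_sym \<times> planar_sym \<Rightarrow> planar_sym option mat set set" where
  "corner_orbit x = orbit planar_group class_act (identical `` {corner_config x})"

text \<open>Removes both quotients at once: the class of \<open>config_act T c\<close> is determined
  by its matrices, which are the transforms of those of \<open>c\<close>. One \<open>T\<close> has
  to serve all k.\<close>

lemma identical_class_orbit_iff:
  assumes c: "c \<in> one_zero_configs" and d: "d \<in> one_zero_configs"
  shows "orbit planar_group class_act (identical `` {c}) = orbit planar_group class_act (identical `` {d})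
    \<longleftrightarrow> (\<exists>T\<in>syms. \<forall>k. transform T (generated c k) = generated d k)"
proof -
  have cc: "c \<in> configurations 2" using c by (simp add: one_zero_configs_def)
  have act: "class_act T (identical `` {c}) = identical `` {d} \<longleftrightarrow>
      (\<forall>k. transform T (generated c k) = generated d k)" if T: "T \<in> syms" for T
    unfolding class_act_class[OF T c] eq_equiv_class_iff[OF equiv_identical one_zero_configs_act[OF T c] d]
    using one_zero_configs_act[OF T c] d by (simp add: identical_def generated_config_act[OF T cc])
  have "orbit planar_group class_act (identical `` {c}) = orbit planar_group class_act (identical `` {d})
      \<longleftrightarrow> identical `` {d} \<in> orbit planar_group class_act (identical `` {c})"
    by (intro group_action.orbit_eq_iff[OF group_action_E2]) (simp_all only: E2_def quotientI c d)
  also have "\<dots> \<longleftrightarrow> (\<exists>T\<in>syms. class_act T (identical `` {c}) = identical `` {d})"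
    unfolding orbit_def by blast
  also have "\<dots> \<longleftrightarrow> (\<exists>T\<in>syms. \<forall>k. transform T (generated c k) = generated d k)"
    by (intro bex_cong refl act)
  finally show ?thesis .
qed

text \<open>Level 0 excludes every \<open>T\<close> except \<open>R 0\<close> and
  \<open>K 1\<close>; the matrices transformed by \<open>K 1\<close> are those of
  \<open>reflect x\<close>.\<close>

lemma corner_orbit_eq_iff:
  assumes x: "x \<in> syms \<times> syms \<times> syms" and y: "y \<in> syms \<times> syms \<times> syms"
  shows "corner_orbit x = corner_orbit y \<longleftrightarrow>
    (\<forall>k. generated (corner_config x) k = generated (corner_config y) k) \<or>
    (\<forall>k. generated (corner_config (reflect x)) k = generated (corner_config y) k)"
proof -
  let ?P = "\<lambda>T. \<forall>k. transform T (generated (corner_config x) k) = generated (corner_config y) k"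
  have "corner_orbit x = corner_orbit y \<longleftrightarrow> (\<exists>T\<in>syms. ?P T)"
    unfolding corner_orbit_def by (intro identical_class_orbit_iff corner_config_one_zero x y)
  also have "\<dots> \<longleftrightarrow> (\<exists>T\<in>{R 0, K 1}. ?P T)"
  proof -
    have "T \<in> {R 0, K 1}" if "T \<in> syms" "?P T" for T
      using corner_config_stabilizer[OF that(1) spec[OF that(2), of 0]] .
    moreover have "{R 0, K 1} \<subseteq> syms" by simp
    ultimately show ?thesis by blast
  qed
  finally show ?thesis by (simp add: generated_reflect[OF x] del: transform.simps(2))
qed

lemma corner_orbit_surj: "corner_orbit ` (syms \<times> syms \<times> syms) = orbits planar_group E2 class_act"
proof
  show "corner_orbit ` (syms \<times> syms \<times> syms) \<subseteq> orbits planar_group E2 class_act"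
    using quotientI[OF corner_config_one_zero, of _ identical]
    by (auto simp: corner_orbit_def orbits_def E2_def)
  show "orbits planar_group E2 class_act \<subseteq> corner_orbit ` (syms \<times> syms \<times> syms)"
  proof
    fix Y assume "Y \<in> orbits planar_group E2 class_act"
    then obtain c where c: "c \<in> one_zero_configs"
      and Y: "Y = orbit planar_group class_act (identical `` {c})"
      by (auto simp: orbits_def E2_def elim!: quotientE)
    have cc: "c \<in> configurations 2" and cm: "c \<in> carrier_mat 2 2"
      using c by (auto simp: one_zero_configs_def configurations_def)
    let ?Z = "{(i, j). i < 2 \<and> j < 2 \<and> c $$ (i, j) = None}"
    have "card ?Z = 1" using c by (simp add: one_zero_configs_def)
    then obtain z where "?Z = {z}" by (rule card_1_singletonE)
    then have "z \<in> ?Z" by simp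
    then obtain i j where "i < 2" "j < 2" "c $$ (i, j) = None" by blast
    then have "c $$ (0, 0) = None \<or> c $$ (0, Suc 0) = None \<or> c $$ (Suc 0, 0) = None \<or>
        c $$ (Suc 0, Suc 0) = None"
      by (auto simp: less_2_cases_iff)
    \<comment> \<open>The four rotations bring each of the four positions to the corner.\<close>
    then have "\<exists>T\<in>{R 0, R 1, R 2, R 3}. config_act T c $$ (0, 0) = None"
      using cm by (auto simp: config_act_conj rot_ccw_def numeral_2_eq_2 numeral_3_eq_3)
    then obtain T where T: "T \<in> syms" "config_act T c $$ (0, 0) = None"
      by (auto simp: planar_carrier)
    obtain x where x: "x \<in> syms \<times> syms \<times> syms" "config_act T c = corner_config x"
      using corner_configI[OF one_zero_configs_act[OF T(1) c] T(2)] by blast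
    have "\<forall>k. transform T (generated c k) = generated (corner_config x) k"
      by (simp only: x(2)[symmetric] generated_config_act[OF T(1) cc] simp_thms)
    then have "Y = corner_orbit x"
      unfolding Y corner_orbit_def identical_class_orbit_iff[OF c corner_config_one_zero[OF x(1)]]
      using T(1) by blast
    then show "Y \<in> corner_orbit ` (syms \<times> syms \<times> syms)" using x(1) by blast
  qed
qed

section \<open>Counting triples and orbits\<close>

lemma finite_syms: "finite syms" and card_syms: "card syms = 8"
  by (simp_all add: planar_carrier)

lemma sym_comp_K1_neq: "g \<in> syms \<Longrightarrow> g \<noteq> sym_comp g (K 1)"
  by (auto simp: planar_carrier)

lemma diag_cosets_closed: "x \<in> syms \<times> syms \<times> syms \<Longrightarrow> diag_cosets x \<subseteq> syms \<times> syms \<times> syms"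
  using monoid.m_closed[OF group.is_monoid[OF group_planar] _ K1_carrier]
  by (auto simp: diag_cosets_def)

lemma card_diag_cosets: "x \<in> syms \<times> syms \<times> syms \<Longrightarrow> card (diag_cosets x) = 8"
  using sym_comp_K1_neq by (fastforce simp: diag_cosets_def card_cartesian_product card_insert_if)

text \<open>By \<open>diag_symmetric_iff\<close> the conditions on the entries decouple:
  \<open>a\<close> is free, then \<open>b\<close> has two values and \<open>e\<close> four, so there
  are 8 * 2 * 4 triples.\<close>

lemma card_diag_symmetric: "card {x \<in> syms \<times> syms \<times> syms. diag_symmetric x} = 64"
proof -
  \<comment> \<open>Solving the first membership for \<open>b\<close> gives these two values, and
    both satisfy the second one.\<close>
  have b: "\<forall>a\<in>syms. \<forall>b\<in>syms.
      planar_conj (K 1) b \<in> {a, sym_comp a (K 1)} \<and> planar_conj (K 1) a \<in> {b, sym_comp b (K 1)}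
      \<longleftrightarrow> b \<in> {sym_comp (K 1) a, planar_conj (K 1) a}"
    unfolding planar_conj_K1 planar_carrier by simp
  \<comment> \<open>The four solutions form the centralizer of \<open>K 1\<close>; the alternative
    \<open>sym_comp e (K 1)\<close> would give \<open>K 1 = R 0\<close> after cancelling.\<close>
  have e: "\<forall>e\<in>syms. planar_conj (K 1) e \<in> {e, sym_comp e (K 1)} \<longleftrightarrow> e \<in> {R 0, R 2, K 1, K 3}"
    unfolding planar_conj_K1 planar_carrier by simp
  have cl: "\<forall>a\<in>syms. {sym_comp (K 1) a, planar_conj (K 1) a} \<subseteq> syms"
    unfolding planar_conj_K1 planar_carrier by simp
  have "{x \<in> syms \<times> syms \<times> syms. diag_symmetric x} =
      (SIGMA a:syms. {sym_comp (K 1) a, planar_conj (K 1) a} \<times> {R 0, R 2, K 1, K 3})"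
  proof (rule Set.set_eqI)
    fix x :: "planar_sym \<times> planar_sym \<times> planar_sym"
    obtain a b f where x: "x = (a, b, f)" by (cases x)
    show "x \<in> {x \<in> syms \<times> syms \<times> syms. diag_symmetric x} \<longleftrightarrow>
      x \<in> (SIGMA a:syms. {sym_comp (K 1) a, planar_conj (K 1) a} \<times> {R 0, R 2, K 1, K 3})"
    proof (cases "x \<in> syms \<times> syms \<times> syms")
      case True
      then have abf: "a \<in> syms" "b \<in> syms" "f \<in> syms" by (simp_all only: x mem_Sigma_iff)
      show ?thesis
        using True b[THEN bspec, THEN bspec, OF abf(1,2)] e[THEN bspec, OF abf(3)]
        by (simp only: x mem_Collect_eq diag_symmetric_iff reflect_def diag_cosets_def prod.case mem_Sigma_iff) blast
    next
      case False
      then show ?thesis using cl by (auto simp: x)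
    qed
  qed
  moreover have "\<forall>a\<in>syms. card ({sym_comp (K 1) a, planar_conj (K 1) a} \<times> {R 0, R 2, K 1, K 3}) = 8"
    unfolding planar_conj_K1 planar_carrier by (simp add: card_cartesian_product)
  ultimately show ?thesis by (simp add: card_SigmaI finite_syms card_syms)
qed

text \<open>Replaces Burnside's formula: \<open>corner_orbit\<close> has fibres of constant size on
  the symmetric and on the nonsymmetric triples.\<close>

lemma card_image_constant_fibre:
  assumes "finite A" "\<And>x. x \<in> A \<Longrightarrow> card {y \<in> A. f y = f x} = m"
  shows "card A = m * card (f ` A)"
proof -
  have "card A = (\<Sum>z\<in>f ` A. card {y \<in> A. f y = z})"
    using sum.image_gen[OF assms(1), of "\<lambda>_. 1::nat" f] by simp
  also have "\<dots> = (\<Sum>z\<in>f ` A. m)" by (rule sum.cong) (auto simp: assms(2))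
  finally show ?thesis by simp
qed

theorem proposition1:
  shows "card (orbits planar_group E2 class_act) = 232"
proof -
  let ?A = "syms \<times> syms \<times> syms"
  let ?S = "{x \<in> ?A. diag_symmetric x}" and ?N = "{x \<in> ?A. \<not> diag_symmetric x}"
  have fin: "finite ?A" by (intro finite_cartesian_product finite_syms)
  have "card ?A = 512" by (simp add: card_cartesian_product card_syms)
  moreover have "?A = ?S \<union> ?N" "?S \<inter> ?N = {}" by auto
  ultimately have "512 = card ?S + card ?N"
    using fin by (metis (no_types, lifting) card_Un_disjoint finite_Un)
  then have cN: "card ?N = 448" using card_diag_symmetric by simp
  \<comment> \<open>Symmetry is an orbit invariant, so the two kinds of triples have disjoint images
    and can be counted separately.\<close>
  have symD: "diag_symmetric y" if "x \<in> ?A" "y \<in> ?A" "corner_orbit y = corner_orbit x" "diag_symmetric x" for x y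
    using that(4) diag_symmetric_reflect[OF that(1)]
      iffD1[OF corner_orbit_eq_iff[OF that(1,2)] that(3)[symmetric]]
    unfolding diag_symmetric_def by metis
  have fibS: "{y \<in> ?S. corner_orbit y = corner_orbit x} = diag_cosets x" if x: "x \<in> ?S" for x
  proof (intro equalityI subsetI)
    fix y assume y: "y \<in> {y \<in> ?S. corner_orbit y = corner_orbit x}"
    have xA: "x \<in> ?A" and yA: "y \<in> ?A" and sym: "diag_symmetric x" using x y by auto
    \<comment> \<open>By symmetry both alternatives of \<open>corner_orbit_eq_iff\<close> say that x
      and y generate the same matrices.\<close>
    have "generated (corner_config (reflect x)) k = generated (corner_config x) k" for k
      using sym by (simp only: generated_reflect[OF xA] diag_symmetric_def)
    then have "generated (corner_config x) k = generated (corner_config y) k" for k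
      using y corner_orbit_eq_iff[OF xA yA] by simp
    then show "y \<in> diag_cosets x" by (rule generated_eq_imp(1)[OF xA yA])
  next
    fix y assume y: "y \<in> diag_cosets x"
    have xA: "x \<in> ?A" and sym: "diag_symmetric x" using x by auto
    have yA: "y \<in> ?A" using diag_cosets_closed[OF xA] y by blast
    have "corner_orbit y = corner_orbit x"
      using corner_orbit_eq_iff[OF yA xA] generated_diag_cosets[OF sym y] by simp
    then show "y \<in> {y \<in> ?S. corner_orbit y = corner_orbit x}"
      using symD[OF xA yA _ sym] yA by blast
  qed
  have fibN: "{y \<in> ?N. corner_orbit y = corner_orbit x} = {x, reflect x}" if x: "x \<in> ?N" for x
  proof (intro equalityI subsetI)
    fix y assume y: "y \<in> {y \<in> ?N. corner_orbit y = corner_orbit x}"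
    have xA: "x \<in> ?A" and yA: "y \<in> ?A" and ns: "\<not> diag_symmetric x" using x y by auto
    \<comment> \<open>Each alternative of \<open>corner_orbit_eq_iff\<close> now forces equality of
      triples: y is x in the first and \<open>reflect x\<close> in the second.\<close>
    have "\<not> diag_symmetric (reflect x)" using ns diag_symmetric_reflect[OF xA] by simp
    then show "y \<in> {x, reflect x}"
      using y corner_orbit_eq_iff[OF xA yA] ns generated_eq_imp(2)[OF xA yA]
        generated_eq_imp(2)[OF reflect_closed[OF xA] yA] by auto
  next
    fix y assume y: "y \<in> {x, reflect x}"
    have xA: "x \<in> ?A" using x by auto
    show "y \<in> {y \<in> ?N. corner_orbit y = corner_orbit x}"
      using y x reflect_closed[OF xA] diag_symmetric_reflect[OF xA]
        corner_orbit_eq_iff[OF xA reflect_closed[OF xA]] by auto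
  qed
  \<comment> \<open>A triple fixed by \<open>reflect\<close> would lie in its own
    \<open>diag_cosets\<close> and hence be symmetric.\<close>
  have neq: "reflect x \<noteq> x" if "x \<in> ?N" for x
    using that diag_symmetric_iff[of x] by (auto simp: diag_cosets_def)
  have "card ?S = 8 * card (corner_orbit ` ?S)"
    by (rule card_image_constant_fibre) (use fin in \<open>simp_all only: fibS, auto simp: card_diag_cosets\<close>)
  moreover have "card ?N = 2 * card (corner_orbit ` ?N)"
  proof (rule card_image_constant_fibre)
    show "finite ?N" using fin by simp
    show "card {y \<in> ?N. corner_orbit y = corner_orbit x} = 2" if "x \<in> ?N" for x
      unfolding fibN[OF that] using neq[OF that] by simp
  qed
  moreover have "orbits planar_group E2 class_act = corner_orbit ` ?S \<union> corner_orbit ` ?N"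
    unfolding corner_orbit_surj[symmetric] by blast
  moreover have "corner_orbit ` ?S \<inter> corner_orbit ` ?N = {}"
  proof (intro equals0I, elim IntE imageE)
    fix z x y assume "x \<in> ?S" "z = corner_orbit x" "y \<in> ?N" "z = corner_orbit y"
    then have xy: "x \<in> ?A" "y \<in> ?A" "corner_orbit y = corner_orbit x" "diag_symmetric x" "\<not> diag_symmetric y"
      by simp_all
    show False by (rule notE[OF xy(5) symD[OF xy(1-4)]])
  qed
  moreover have "finite (corner_orbit ` ?S)" "finite (corner_orbit ` ?N)" using fin by simp_all
  ultimately have "card (orbits planar_group E2 class_act) =
      card (corner_orbit ` ?S) + card (corner_orbit ` ?N)"
    "card ?S = 8 * card (corner_orbit ` ?S)" "card ?N = 2 * card (corner_orbit ` ?N)"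
    by (simp_all only: card_Un_disjoint)
  \<comment> \<open>The 64 symmetric triples give 8 orbits, the other 448 give 224.\<close>
  then show ?thesis using cN card_diag_symmetric by linarith
qed

end
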